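(* Let $G$ be a connected uniform graph and let $r\ge2$ be an integer. If every minimal vertex $r$-separator in $G$ has diameter at most $m$, where $m\le r$, then $G$ is $(r+\frac12)$-densely $(2r+2,r)$-chordal.
   Context: Every edge of the connected graph $G$ has length $1$, interior points of edges are points of $G$, and $d$ is the induced shortest-path (length) metric on $G$; $V(G)$ is the vertex set. Diameters are taken with respect to $d$. $G$ is uniform if there is a constant $\mu$ such that every vertex has at most $\mu$ neighbors. Given $r\in\mathbb{N}$, two vertices $a,b$ are $r$-separated by $S\subset V(G)$ (and $S$ is called an $ab$-$r$-separator) if, denoting by $G_a$ and $G_b$ the connected components of $G\setminus S$ containing $a$ and $b$ respectively, $d(v,w)>r$ for every pair of vertices $v\in G_a$, $w\in G_b$. $S$ is a minimal $ab$-$r$-separator if it is an $ab$-$r$-separator and no proper subset of $S$ $r$-separates $a$ and $b$. $S$ is a minimal vertex $r$-separator if it is a minimal $ab$-$r$-separator for some pair of vertices $a,b$. Paths are finite and simple. A cycle is a simple closed curve, given by a sequence of vertices all different except that the first and last coincide. $L(\cdot)$ denotes length. For a cycle $C$, $d_C$ denotes the length metric on $C$. A shortcut in $C$ is a path $\sigma$ in $G$ joining two vertices $p,q$ of $C$ with $L(\sigma)<d_C(p,q)$; it is strict if $\sigma\cap C=\{p,q\}$, and then $p,q$ are the shortcut vertices associated to $\sigma$. A subset $A$ of a metric space $(X,\rho)$ is $\varepsilon$-dense if for every $x\in X$ there is $a\in A$ with $\rho(a,x)<\varepsilon$. $G$ is $\varepsilon$-densely $(k,m)$-chordal if for every cycle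 $C$ with $L(C)\ge k$ there exist finitely many strict shortcuts $\sigma_1,\dots,\sigma_s$ in $C$ with $L(\sigma_i)\le m$ for all $i$ whose associated shortcut vertices form an $\varepsilon$-dense subset of $(C,d_C)$. *)

theory Defs
  imports "Graph_Theory.Graph_Theory"
begin

text \<open>
  Simple, possibly infinite, undirected graphs are the loop-free symmetric digraphs of the locale
  \<^locale>\<open>pair_bidirected_digraph\<close>: an undirected edge is a pair of opposite arcs. Every metric
  quantity below except the one in \<open>\<epsilon>\<close>-density (see \<open>cycle_dist\<close>) concerns vertices only, where
  the length metric is the usual shortest-path distance.
\<close>

definition eps_dense :: "'b set \<Rightarrow> ('b \<Rightarrow> 'b \<Rightarrow> real) \<Rightarrow> real \<Rightarrow> 'b set \<Rightarrow> bool" where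
  "eps_dense X \<rho> \<epsilon> A \<longleftrightarrow> A \<subseteq> X \<and> (\<forall>x\<in>X. \<exists>a\<in>A. \<rho> a x < \<epsilon>)"

context pair_bidirected_digraph
begin

text \<open>\<open>out_degree\<close> would not do here: it is a cardinality, hence \<open>0\<close> for infinitely many neighbours.\<close>

definition is_uniform :: bool where
  "is_uniform \<longleftrightarrow> (\<exists>\<mu>\<^sub>0::nat. \<forall>v\<in>pverts G.
      finite {w. (v, w) \<in> parcs G} \<and> card {w. (v, w) \<in> parcs G} \<le> \<mu>\<^sub>0)"

definition gdist :: "'a \<Rightarrow> 'a \<Rightarrow> ereal" where
  "gdist v w = \<mu> (\<lambda>_. 1) v w"

definition gdiam :: "'a set \<Rightarrow> ereal" where
  "gdiam S = Sup (insert 0 {gdist v w | v w. v \<in> S \<and> w \<in> S})"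

text \<open>
  The vertices of the connected component of \<open>G \<setminus> S\<close> containing \<open>a\<close>. For symmetric digraphs the
  strongly connected components are the connected components.
\<close>

definition component_minus :: "'a set \<Rightarrow> 'a \<Rightarrow> 'a set" where
  "component_minus S a = pre_digraph.scc_of (with_proj G \<restriction> (pverts G - S)) a"

definition r_separator :: "nat \<Rightarrow> 'a \<Rightarrow> 'a \<Rightarrow> 'a set \<Rightarrow> bool" where
  "r_separator r a b S \<longleftrightarrow>
     S \<subseteq> pverts G \<and> a \<in> pverts G - S \<and> b \<in> pverts G - S \<and>
     (\<forall>v\<in>component_minus S a. \<forall>w\<in>component_minus S b. gdist v w > ereal (real r))"

definition minimal_r_separator :: "nat \<Rightarrow> 'a \<Rightarrow> 'a \<Rightarrow> 'a set \<Rightarrow> bool" where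
  "minimal_r_separator r a b S \<longleftrightarrow>
     r_separator r a b S \<and> (\<forall>S'. S' \<subset> S \<longrightarrow> \<not> r_separator r a b S')"

definition minimal_vertex_r_separator :: "nat \<Rightarrow> 'a set \<Rightarrow> bool" where
  "minimal_vertex_r_separator r S \<longleftrightarrow> (\<exists>a b. minimal_r_separator r a b S)"

text \<open>
  A cycle is given by its list of arcs \<open>[(v\<^sub>0, v\<^sub>1), (v\<^sub>1, v\<^sub>2), \<dots>, (v\<^sub>n\<^sub>-\<^sub>1, v\<^sub>0)]\<close>. The length bound
  excludes \<open>u, v, u\<close>, which \<^const>\<open>cycle\<close> accepts but which is not a simple closed curve.
\<close>

definition graph_cycle :: "('a \<times> 'a) list \<Rightarrow> bool" where
  "graph_cycle C \<longleftrightarrow> cycle C \<and> length C \<ge> 3"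

definition cycle_vertex :: "('a \<times> 'a) list \<Rightarrow> nat \<Rightarrow> 'a" where
  "cycle_vertex C i = fst (C ! i)"

text \<open>
  The points of a cycle \<open>C\<close> of length \<open>n\<close>, interior points of edges included, are parametrised
  bijectively by arc length \<open>t\<close> in \<open>[0, n)\<close>: the integer \<open>i\<close> stands for the vertex
  \<open>cycle_vertex C i\<close>, and \<open>i + s\<close> with \<open>0 < s < 1\<close> for the point of the edge \<open>C ! i\<close> at distance
  \<open>s\<close> from that vertex. The length metric \<open>d\<^sub>C\<close> is the length of the shorter of the two arcs.
\<close>

definition cycle_points :: "('a \<times> 'a) list \<Rightarrow> real set" where
  "cycle_points C = {0..<real (length C)}"

definition cycle_dist :: "('a \<times> 'a) list \<Rightarrow> real \<Rightarrow> real \<Rightarrow> real" where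
  "cycle_dist C s t = min \<bar>s - t\<bar> (real (length C) - \<bar>s - t\<bar>)"

text \<open>A path \<open>\<sigma>\<close> from \<open>cycle_vertex C i\<close> to \<open>cycle_vertex C j\<close>, as a list of arcs.\<close>

definition shortcut :: "('a \<times> 'a) list \<Rightarrow> nat \<Rightarrow> nat \<Rightarrow> ('a \<times> 'a) list \<Rightarrow> bool" where
  "shortcut C i j \<sigma> \<longleftrightarrow>
     i < length C \<and> j < length C \<and>
     apath (cycle_vertex C i) \<sigma> (cycle_vertex C j) \<and>
     real (length \<sigma>) < cycle_dist C (real i) (real j)"

text \<open>
  The intersection of \<open>\<sigma>\<close> and \<open>C\<close> is one of point sets: besides the two end vertices they share
  neither a vertex nor an (undirected) edge.
\<close>

definition strict_shortcut :: "('a \<times> 'a) list \<Rightarrow> nat \<Rightarrow> nat \<Rightarrow> ('a \<times> 'a) list \<Rightarrow> bool" where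
  "strict_shortcut C i j \<sigma> \<longleftrightarrow>
     shortcut C i j \<sigma> \<and>
     set (awalk_verts (cycle_vertex C i) \<sigma>) \<inter> cycle_vertex C ` {..<length C}
       = {cycle_vertex C i, cycle_vertex C j} \<and>
     (\<forall>(u, v)\<in>set \<sigma>. (u, v) \<notin> set C \<and> (v, u) \<notin> set C)"

text \<open>The finite family of shortcuts is a finite set \<open>F\<close> of triples \<open>(i, j, \<sigma>)\<close>.\<close>

definition densely_chordal :: "real \<Rightarrow> real \<Rightarrow> real \<Rightarrow> bool" where
  "densely_chordal \<epsilon> k m \<longleftrightarrow>
     (\<forall>C. graph_cycle C \<and> real (length C) \<ge> k \<longrightarrow>
        (\<exists>F. finite F \<and>
             (\<forall>(i, j, \<sigma>)\<in>F. strict_shortcut C i j \<sigma> \<and> real (length \<sigma>) \<le> m) \<and>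
             eps_dense (cycle_points C) (cycle_dist C) \<epsilon>
               (\<Union>(i, j, \<sigma>)\<in>F. {real i, real j})))"

end

end

theory Submission
  imports Defs
begin

text \<open>
  Number the vertices of a cycle \<open>C\<close> of length \<open>n \<ge> 2r + 2\<close> as \<open>c\<^sub>0, c\<^sub>1, \<dots>, c\<^sub>n = c\<^sub>0\<close>, starting from
  any of them. The heart of the proof (\<open>shortcut_vertex_near_edge\<close>) is that some strict shortcut of
  length at most \<open>r\<close> has an end within cycle distance \<open>r - 1\<close> of \<open>c\<^sub>0\<close> or of \<open>c\<^sub>1\<close>. Every point of
  the edge \<open>c\<^sub>0c\<^sub>1\<close> is within distance \<open>1\<close> of both, hence within \<open>r\<close> of a shortcut vertex, and letting
  the edge run through \<open>C\<close> gives the density.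

  It is enough to find two vertices of \<open>C\<close>, one of them \<open>c\<^sub>0\<close> or \<open>c\<^sub>1\<close>, which are at distance at most
  \<open>r\<close> in \<open>G\<close> and at least \<open>r + 1\<close> in \<open>C\<close>: a walk shorter in \<open>G\<close> than in \<open>C\<close> contains a strict
  shortcut, and up to the first such shortcut it stays as close to its origin in \<open>C\<close> as its own
  length (\<open>ex_strict_shortcut\<close>).

  If \<open>c\<^sub>0\<close> and \<open>c\<^sub>r\<^sub>+\<^sub>1\<close> are at distance at most \<open>r\<close> in \<open>G\<close>, they are such a pair. Otherwise all other
  vertices together \<open>r\<close>-separate them, and Zorn's lemma gives a minimal separator \<open>S\<close>
  (\<open>ex_minimal_r_separator\<close>). The vertex \<open>c\<^sub>1\<close> belongs to \<open>S\<close>, since otherwise it would lie in the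
  component of \<open>c\<^sub>0\<close> although it is only \<open>r\<close> steps away from \<open>c\<^sub>r\<^sub>+\<^sub>1\<close>. Walking on from \<open>c\<^sub>r\<^sub>+\<^sub>1\<close> one
  meets \<open>S\<close> again, for the first time in some \<open>c\<^sub>k\<close>. Its predecessor still lies in the component of
  \<open>c\<^sub>r\<^sub>+\<^sub>1\<close>, so it is more than \<open>r\<close> steps away from \<open>c\<^sub>n = c\<^sub>0\<close>; this places \<open>c\<^sub>k\<close> at cycle
  distance at least \<open>r + 1\<close> from \<open>c\<^sub>1\<close>, while both lie in \<open>S\<close>, whose diameter is at most \<open>r\<close>.
\<close>

context pair_bidirected_digraph
begin

section \<open>Distances and walks\<close>

lemma awalk_cost_unit: "awalk_cost (\<lambda>_. 1) p = real (length p)"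
  by (induct p) auto

lemma length_awalk_to_apath_le:
  assumes p: "awalk u p v" shows "length (awalk_to_apath p) \<le> length p"
proof -
  have "distinct (awalk_to_apath p)"
    using apath_awalk_to_apath[OF p] distinct_verts_imp_distinct
    unfolding apath_def by blast
  then have "length (awalk_to_apath p) = card (set (awalk_to_apath p))"
    by (rule distinct_card[symmetric])
  also have "\<dots> \<le> card (set p)" by (intro card_mono awalk_to_apath_subset[OF p]) simp
  also have "\<dots> \<le> length p" by (rule card_length)
  finally show ?thesis .
qed

lemma gdist_le_iff: "gdist u v \<le> ereal (real k) \<longleftrightarrow> (\<exists>p. awalk u p v \<and> length p \<le> k)"
proof
  assume "gdist u v \<le> ereal (real k)"
  also have "\<dots> < ereal (real k + 1)" by simp
  finally obtain p where "awalk u p v" "ereal (awalk_cost (\<lambda>_. 1) p) < ereal (real k + 1)"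
    unfolding gdist_def \<mu>_def by (auto simp: INF_less_iff)
  then show "\<exists>p. awalk u p v \<and> length p \<le> k"
    by (intro exI[of _ p]) (auto simp: awalk_cost_unit)
next
  assume "\<exists>p. awalk u p v \<and> length p \<le> k"
  then obtain p where p: "awalk u p v" "length p \<le> k" by blast
  have "gdist u v \<le> ereal (awalk_cost (\<lambda>_. 1) p)"
    unfolding gdist_def by (rule min_cost_le_walk_cost[OF p(1)])
  also have "\<dots> \<le> ereal (real k)" using p(2) by (simp add: awalk_cost_unit)
  finally show "gdist u v \<le> ereal (real k)" .
qed

lemma gdist_commute_le: "gdist u v \<le> ereal (real k) \<Longrightarrow> gdist v u \<le> ereal (real k)"
proof -
  have len: "length (rev_path p) = length p" for p :: "('a \<times> 'a) list" by (induct p) auto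
  assume "gdist u v \<le> ereal (real k)"
  then obtain p where p: "awalk u p v" "length p \<le> k" by (auto simp: gdist_le_iff)
  then have "awalk v (rev_path p) u" "length (rev_path p) \<le> k" by (simp_all add: len)
  then show ?thesis unfolding gdist_le_iff by blast
qed

lemma gdist_le_gdiam: "u \<in> S \<Longrightarrow> v \<in> S \<Longrightarrow> gdist u v \<le> gdiam S"
  unfolding gdiam_def by (rule Sup_upper) blast

section \<open>Components of the complement of a vertex set\<close>

text \<open>
  In a symmetric digraph reachability is symmetric, so that the strongly connected component of \<open>a\<close>
  is just what can be reached from \<open>a\<close>. The closure and induction rules below rest on this form.
\<close>

lemma component_minus_reachable:
  "component_minus S a = {v. a \<rightarrow>\<^sup>*\<^bsub>with_proj G \<restriction> (pverts G - S)\<^esub> v}"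
proof -
  let ?H = "with_proj G \<restriction> (pverts G - S)"
  have "symmetric ?H"
    unfolding symmetric_def
    by (rule symI) (auto simp: arcs_ends_conv dest: arcs_symmetric)
  then show ?thesis
    unfolding component_minus_def pre_digraph.scc_of_def
    by (auto intro: symmetric_reachable)
qed

lemma component_minus_self: "a \<in> pverts G \<Longrightarrow> a \<notin> S \<Longrightarrow> a \<in> component_minus S a"
  unfolding component_minus_reachable by (auto simp: reachable_def)

lemma component_minus_not_in: "v \<in> component_minus S a \<Longrightarrow> v \<in> pverts G - S"
  unfolding component_minus_reachable
  by (auto elim: reachable_in_vertsE)

lemma component_minus_step:
  assumes u: "u \<in> component_minus S a" and arc: "(u, v) \<in> parcs G" and v: "v \<notin> S"
  shows "v \<in> component_minus S a"
proof -
  interpret H: wf_digraph "with_proj G \<restriction> (pverts G - S)" by (rule wellformed_induce_subgraph)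
  have "u \<rightarrow>\<^bsub>with_proj G \<restriction> (pverts G - S)\<^esub> v"
    using component_minus_not_in[OF u] arc v
    by (auto simp: arcs_ends_conv image_iff wellformed' intro!: bexI[of _ "(u, v)"])
  then show ?thesis
    using u unfolding component_minus_reachable by (auto intro: H.reachable_adj_trans)
qed

lemma component_minus_induct [consumes 1, case_names base step]:
  assumes "v \<in> component_minus S a" and "P a"
    and "\<And>u v. u \<in> component_minus S a \<Longrightarrow> (u, v) \<in> parcs G \<Longrightarrow> v \<in> pverts G - S \<Longrightarrow> P u \<Longrightarrow> P v"
  shows "P v"
proof -
  interpret H: wf_digraph "with_proj G \<restriction> (pverts G - S)" by (rule wellformed_induce_subgraph)
  have "a \<rightarrow>\<^sup>*\<^bsub>with_proj G \<restriction> (pverts G - S)\<^esub> v"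
    using assms(1) by (simp add: component_minus_reachable)
  then show ?thesis
  proof (induct rule: H.reachable_induct)
    case base
    show ?case by fact
  next
    case (step u v)
    then have "(u, v) \<in> parcs G \<and> v \<in> pverts G - S"
      by (auto simp: arcs_ends_conv)
    with step show ?case
      using assms(3)[of u v] by (simp add: component_minus_reachable)
  qed
qed

lemma component_minus_antimono:
  assumes "S \<subseteq> S'" and a: "a \<in> pverts G - S"
  shows "component_minus S' a \<subseteq> component_minus S a"
proof
  fix v assume "v \<in> component_minus S' a"
  then show "v \<in> component_minus S a"
    using assms by (induct rule: component_minus_induct)
      (auto intro: component_minus_self component_minus_step)
qed

section \<open>Minimal separators exist\<close>

text \<open>
  Zorn's lemma is used for the complements \<open>T\<close> of separators, so that minimal separators become
  maximal sets and intersections of separators become unions. The point of passing to the union of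
  a chain is that a walk has only finitely many vertices: if it stays inside the union, it already
  stays inside one member. The induction below collects these vertices one by one.
\<close>

lemma component_minus_chain:
  assumes chain: "\<And>X Y. X \<in> \<C> \<Longrightarrow> Y \<in> \<C> \<Longrightarrow> X \<subseteq> Y \<or> Y \<subseteq> X"
    and ne: "\<C> \<noteq> {}" and a: "a \<in> pverts G" "\<And>T. T \<in> \<C> \<Longrightarrow> a \<in> T"
    and v: "v \<in> component_minus (pverts G - \<Union>\<C>) a"
  shows "\<exists>T\<in>\<C>. v \<in> component_minus (pverts G - T) a"
  using v
proof (induct rule: component_minus_induct)
  case base
  then show ?case using ne a by (auto intro!: component_minus_self)
next
  case (step u v)
  then obtain T T' where T: "T \<in> \<C>" "u \<in> component_minus (pverts G - T) a"
    and T': "T' \<in> \<C>" "v \<in> T'" by auto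
  obtain M where M: "M \<in> \<C>" "T \<subseteq> M" "T' \<subseteq> M" using chain[OF T(1) T'(1)] T(1) T'(1) by blast
  have "component_minus (pverts G - T) a \<subseteq> component_minus (pverts G - M) a"
    using M a by (intro component_minus_antimono) auto
  then have "v \<in> component_minus (pverts G - M) a"
    using T(2) T'(2) M(3) step(2) by (blast intro: component_minus_step)
  then show ?case using M(1) by blast
qed

text \<open>
  Two vertices further than \<open>r \<ge> 1\<close> apart are not adjacent; once all others are removed, each is
  a component of its own.
\<close>

lemma ex_r_separator:
  assumes "a \<in> pverts G" "b \<in> pverts G" and far: "gdist a b > ereal (real r)" and "r \<ge> 1"
  shows "r_separator r a b (pverts G - {a, b})"
proof -
  have nadj: "(a, b) \<notin> parcs G" "(b, a) \<notin> parcs G"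
  proof -
    show "(a, b) \<notin> parcs G"
    proof
      assume "(a, b) \<in> parcs G"
      then have "awalk a [(a, b)] b" by (auto simp: awalk_simps wellformed')
      then have "gdist a b \<le> ereal (real r)" using \<open>r \<ge> 1\<close> unfolding gdist_le_iff by force
      with far show False by simp
    qed
    then show "(b, a) \<notin> parcs G" using arcs_symmetric by blast
  qed
  have "v = a" if "v \<in> component_minus (pverts G - {a, b}) a" for v
    using that nadj no_loops' by (induct rule: component_minus_induct) auto
  moreover have "v = b" if "v \<in> component_minus (pverts G - {a, b}) b" for v
    using that nadj no_loops' by (induct rule: component_minus_induct) auto
  ultimately show ?thesis unfolding r_separator_def using assms by auto
qed

lemma ex_minimal_r_separator:
  assumes a: "a \<in> pverts G" and b: "b \<in> pverts G" and far: "gdist a b > ereal (real r)" and "r \<ge> 1"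
  obtains S where "minimal_r_separator r a b S"
proof -
  define \<A> where "\<A> = {T. T \<subseteq> pverts G \<and> r_separator r a b (pverts G - T)}"
  have "{a, b} \<in> \<A>" unfolding \<A>_def using ex_r_separator[OF assms] a b by auto
  have "\<exists>M\<in>\<A>. \<forall>X\<in>\<A>. M \<subseteq> X \<longrightarrow> X = M"
  proof (rule subset_Zorn_nonempty)
    show "\<A> \<noteq> {}" using \<open>{a, b} \<in> \<A>\<close> by auto
    fix \<C> assume ne: "\<C> \<noteq> {}" and ch: "subset.chain \<A> \<C>"
    then have sub: "\<C> \<subseteq> \<A>" and chain: "\<And>X Y. X \<in> \<C> \<Longrightarrow> Y \<in> \<C> \<Longrightarrow> X \<subseteq> Y \<or> Y \<subseteq> X"
      by (auto simp: subset_chain_def)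
    have aT: "a \<in> T" and bT: "b \<in> T" if "T \<in> \<C>" for T
      using that sub unfolding \<A>_def r_separator_def by auto
    have "gdist v w > ereal (real r)"
      if v: "v \<in> component_minus (pverts G - \<Union>\<C>) a" and w: "w \<in> component_minus (pverts G - \<Union>\<C>) b"
      for v w
    proof -
      obtain T where T: "T \<in> \<C>" "v \<in> component_minus (pverts G - T) a"
        using component_minus_chain[OF chain ne a aT v] by auto
      obtain T' where T': "T' \<in> \<C>" "w \<in> component_minus (pverts G - T') b"
        using component_minus_chain[OF chain ne b bT w] by auto
      \<comment> \<open>A single member of the chain sees both walks, so its separation property applies.\<close>
      obtain M where M: "M \<in> \<C>" "T \<subseteq> M" "T' \<subseteq> M" using chain[OF T(1) T'(1)] T(1) T'(1) by blast
      have "v \<in> component_minus (pverts G - M) a" "w \<in> component_minus (pverts G - M) b"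
        using component_minus_antimono[of "pverts G - M" "pverts G - T" a]
          component_minus_antimono[of "pverts G - M" "pverts G - T'" b] M T T' a b aT bT by auto
      moreover have "r_separator r a b (pverts G - M)" using M(1) sub unfolding \<A>_def by auto
      ultimately show ?thesis unfolding r_separator_def by blast
    qed
    then show "\<Union>\<C> \<in> \<A>"
      using sub ne a b aT bT unfolding \<A>_def r_separator_def by blast
  qed
  then obtain M where M: "M \<in> \<A>" and max: "\<And>X. X \<in> \<A> \<Longrightarrow> M \<subseteq> X \<Longrightarrow> X = M" by blast
  have "minimal_r_separator r a b (pverts G - M)"
    unfolding minimal_r_separator_def
  proof (intro conjI allI impI notI)
    show "r_separator r a b (pverts G - M)" using M unfolding \<A>_def by simp
    fix S' assume S': "S' \<subset> pverts G - M" and sep: "r_separator r a b S'"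
    have "pverts G - (pverts G - S') = S'" using S' by blast
    then have "pverts G - S' \<in> \<A>" using sep unfolding \<A>_def by simp
    moreover have "M \<subseteq> pverts G - S'" using M S' unfolding \<A>_def by blast
    ultimately have "pverts G - S' = M" by (rule max)
    then show False using S' by blast
  qed
  then show ?thesis by (rule that)
qed

section \<open>The metric of a cycle\<close>

lemma cycle_dist_commute: "cycle_dist C s t = cycle_dist C t s"
  by (simp add: cycle_dist_def abs_minus_commute)

lemma cycle_dist_triangle:
  assumes "s \<in> cycle_points C" "t \<in> cycle_points C" "u \<in> cycle_points C"
  shows "cycle_dist C s u \<le> cycle_dist C s t + cycle_dist C t u"
  using assms unfolding cycle_dist_def cycle_points_def by (auto simp: min_def abs_if)

text \<open>
  Rotating the cycle preserves its metric. Allowing \<open>l = length C\<close> admits the starting vertex a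
  second time, as the end of the full turn.
\<close>

lemma cycle_dist_shift:
  assumes "i < length C" "k \<le> l" "l \<le> length C"
  shows "cycle_dist C (real ((i + k) mod length C)) (real ((i + l) mod length C))
    = min (real l - real k) (real (length C) - (real l - real k))"
proof -
  have m: "(i + x) mod length C = (if i + x < length C then i + x else i + x - length C)"
    if "x \<le> length C" for x
    using that assms(1) by (auto simp: mod_if)
  show ?thesis
    unfolding m[OF assms(3)] m[OF order_trans[OF assms(2,3)]] cycle_dist_def
    using assms by (auto simp: min_def abs_if of_nat_diff)
qed

lemma graph_cycle_distinct:
  assumes "graph_cycle C" shows "distinct (map fst C)"
proof -
  from assms obtain u where u: "awalk u C u" "distinct (tl (pawalk_verts u C))" "C \<noteq> []"
    unfolding graph_cycle_def cycle_def by auto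
  have "pawalk_verts u C = map fst C @ [u]"
    using u(1,3) awalk_verts_conv[of u C] awlast_of_awalk[of u C u]
    by (cases "last C") (auto simp: awalk_def)
  with u(2,3) have "distinct (tl (map fst C) @ [u])" by (cases C) auto
  moreover have "u = hd (map fst C)" using u(1,3) by (cases C) (auto simp: awalk_simps)
  ultimately show ?thesis using u(3) by (cases C) auto
qed

lemma cycle_vertex_inj:
  assumes "graph_cycle C" "i < length C" "j < length C" "cycle_vertex C i = cycle_vertex C j"
  shows "i = j"
  using nth_eq_iff_index_eq[OF graph_cycle_distinct[OF assms(1)], of i j] assms(2-4)
  by (simp add: cycle_vertex_def)

lemma cycle_arc:
  assumes "graph_cycle C" "i < length C"
  shows "C ! i = (cycle_vertex C i, cycle_vertex C (Suc i mod length C))" "C ! i \<in> parcs G"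
proof -
  from assms obtain u where u: "awalk u C u" "C \<noteq> []"
    unfolding graph_cycle_def cycle_def by auto
  show "C ! i \<in> parcs G" using u(1) assms(2) by (auto simp: awalk_def)
  have hd: "fst (C ! 0) = u" using u by (cases C) (auto simp: awalk_simps)
  have last: "snd (last C) = u"
    using awalk_verts_conv[of u C] u awlast_of_awalk[of u C u] by (auto simp: awalk_def)
  have eq: "map fst C @ [snd (last C)] = u # map snd C"
    using awalk_verts_conv[of u C] awalk_verts_conv'[of u C u] u hd
    by (auto simp: awalk_def hd_conv_nth)
  have "snd (C ! i) = fst (C ! (Suc i mod length C))"
  proof (cases "Suc i < length C")
    case True
    then show ?thesis using arg_cong[OF eq, of "\<lambda>xs. xs ! Suc i"] by (simp add: nth_append)
  next
    case False
    then have "Suc i = length C" using assms(2) by simp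
    then show ?thesis using last hd u(2) by (simp add: last_conv_nth flip: \<open>Suc i = _\<close>)
  qed
  then show "C ! i = (cycle_vertex C i, cycle_vertex C (Suc i mod length C))"
    by (simp add: cycle_vertex_def prod_eq_iff)
qed


lemma arc_ends_on_cycle:
  assumes C: "graph_cycle C" and uv: "(u, v) \<in> set C"
  shows "u \<in> cycle_vertex C ` {..<length C}" "v \<in> cycle_vertex C ` {..<length C}"
proof -
  obtain k where k: "k < length C" "C ! k = (u, v)" using uv by (auto simp: in_set_conv_nth)
  then have len: "Suc k mod length C < length C" by (intro mod_less_divisor) auto
  have "(u, v) = (cycle_vertex C k, cycle_vertex C (Suc k mod length C))"
    by (rule trans[OF k(2)[symmetric] cycle_arc(1)[OF C k(1)]])
  with k(1) len show "u \<in> cycle_vertex C ` {..<length C}" "v \<in> cycle_vertex C ` {..<length C}"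
    by blast+
qed

lemma cycle_walk:
  assumes C: "graph_cycle C"
  shows "\<exists>p. awalk (cycle_vertex C (k mod length C)) p (cycle_vertex C ((k + l) mod length C)) \<and> length p = l"
proof (induct l)
  case 0
  have "k mod length C < length C" using C by (auto simp: graph_cycle_def intro!: mod_less_divisor)
  from cycle_arc(2)[OF C this] have "cycle_vertex C (k mod length C) \<in> pverts G"
    by (auto simp: cycle_vertex_def arc_fst_in_verts)
  then show ?case by (auto simp: awalk_simps)
next
  case (Suc l)
  let ?i = "(k + l) mod length C"
  from Suc obtain p where p: "awalk (cycle_vertex C (k mod length C)) p (cycle_vertex C ?i)" "length p = l"
    by blast
  have i: "?i < length C" using C by (auto simp: graph_cycle_def intro!: mod_less_divisor)
  have "awalk (cycle_vertex C ?i) [C ! ?i] (cycle_vertex C ((k + Suc l) mod length C))"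
    using cycle_arc[OF C i] by (auto simp: awalk_simps mod_Suc_eq wellformed')
  with p show ?case by (intro exI[of _ "p @ [C ! ?i]"]) auto
qed

lemma gdist_cycle_le:
  assumes "graph_cycle C"
  shows "gdist (cycle_vertex C (k mod length C)) (cycle_vertex C ((k + l) mod length C)) \<le> ereal (real l)"
  using cycle_walk[OF assms, of k l] unfolding gdist_le_iff by auto

section \<open>Strict shortcuts\<close>

lemma cycle_dist_le_1_if_adjacent:
  assumes C: "graph_cycle C" and ij: "i < length C" "j < length C"
    and arc: "(cycle_vertex C i, cycle_vertex C j) \<in> set C"
  shows "cycle_dist C (real i) (real j) \<le> 1"
proof -
  obtain k where k: "k < length C" "C ! k = (cycle_vertex C i, cycle_vertex C j)"
    using arc by (auto simp: in_set_conv_nth)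
  have len: "Suc k mod length C < length C" using k(1) by (intro mod_less_divisor) auto
  have "k = i" "Suc k mod length C = j"
    using k cycle_arc(1)[OF C k(1)] cycle_vertex_inj[OF C k(1) ij(1)] cycle_vertex_inj[OF C len ij(2)]
    by auto
  then show ?thesis
    using cycle_dist_shift[of i C 0 1] ij by (auto simp: min_def)
qed

text \<open>
  The proof takes a shortest path \<open>\<sigma>\<close> among all shortcuts, from \<open>i'\<close> to \<open>j'\<close>, subject to the
  inequality claimed in the conclusion. If \<open>\<sigma>\<close> met the cycle at a further vertex \<open>k\<close>, its two parts
  would be shorter. The first part has the same origin and would be a smaller competitor if it were
  a shortcut; so it is at least as long as the cycle distance from \<open>i'\<close> to \<open>k\<close>. By the triangle
  inequality the second part then is a shortcut and satisfies the inequality too, contradicting the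
  choice of \<open>\<sigma>\<close>.
\<close>

lemma ex_strict_shortcut:
  assumes C: "graph_cycle C" and ij: "i < length C" "j < length C"
    and p: "awalk (cycle_vertex C i) p (cycle_vertex C j)"
    and short: "real (length p) < cycle_dist C (real i) (real j)"
  obtains i' j' \<sigma> where "strict_shortcut C i' j' \<sigma>"
    "cycle_dist C (real i) (real i') + real (length \<sigma>) \<le> real (length p)"
proof -
  define P where "P = (\<lambda>(i', j', \<sigma>). shortcut C i' j' \<sigma> \<and>
    cycle_dist C (real i) (real i') + real (length \<sigma>) \<le> real (length p))"
  have pts: "real k \<in> cycle_points C" if "k < length C" for k
    using that by (simp add: cycle_points_def)
  have start: "P (i, j, awalk_to_apath p)"
    using p short ij length_awalk_to_apath_le[OF p] apath_awalk_to_apath[OF p]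
    by (auto simp: P_def shortcut_def cycle_dist_def)
  obtain i' j' \<sigma> where \<sigma>: "P (i', j', \<sigma>)"
    and least: "\<And>i'' j'' \<tau>. P (i'', j'', \<tau>) \<Longrightarrow> length \<sigma> \<le> length \<tau>"
    using ex_has_least_nat[of P "(i, j, awalk_to_apath p)" "\<lambda>(_, _, \<tau>). length \<tau>"] start by auto
  from \<sigma> have i': "i' < length C" and j': "j' < length C"
    and apath: "apath (cycle_vertex C i') \<sigma> (cycle_vertex C j')"
    and shorter: "real (length \<sigma>) < cycle_dist C (real i') (real j')"
    and near: "cycle_dist C (real i) (real i') + real (length \<sigma>) \<le> real (length p)"
    by (auto simp: P_def shortcut_def)
  have inter: "cycle_vertex C k = cycle_vertex C i' \<or> cycle_vertex C k = cycle_vertex C j'"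
    if k: "k < length C" and kin: "cycle_vertex C k \<in> set (pawalk_verts (cycle_vertex C i') \<sigma>)" for k
  proof (rule ccontr)
    assume ne: "\<not> ?thesis"
    obtain q s where qs: "\<sigma> = q @ s" "awalk (cycle_vertex C i') q (cycle_vertex C k)"
      "awalk (cycle_vertex C k) s (cycle_vertex C j')"
      using awalk_decomp[OF awalkI_apath[OF apath] kin] by blast
    have "q \<noteq> []" "s \<noteq> []" using qs(2,3) ne by (auto simp: awalk_simps)
    have ap: "apath (cycle_vertex C i') q (cycle_vertex C k)" "apath (cycle_vertex C k) s (cycle_vertex C j')"
      using apath qs by (auto simp: apath_append_iff)
    have nq: "\<not> P (i', k, q)" using least[of i' k q] \<open>s \<noteq> []\<close> qs(1) by auto
    have ns: "\<not> P (k, j', s)" using least[of k j' s] \<open>q \<noteq> []\<close> qs(1) by auto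
    have long: "cycle_dist C (real i') (real k) \<le> real (length q)"
      using nq near ap(1) i' k qs(1) by (auto simp: P_def shortcut_def)
    have "real (length s) < cycle_dist C (real k) (real j')"
      using shorter qs(1) long cycle_dist_triangle[OF pts[OF i'] pts[OF k] pts[OF j']] by simp
    moreover have "cycle_dist C (real i) (real k) + real (length s) \<le> real (length p)"
      using near qs(1) long cycle_dist_triangle[OF pts[OF ij(1)] pts[OF i'] pts[OF k]] by simp
    ultimately have "P (k, j', s)" using ap(2) k j' by (auto simp: P_def shortcut_def)
    with ns show False by simp
  qed
  \<comment> \<open>An edge of the cycle on \<open>\<sigma>\<close> would join the two ends of \<open>\<sigma>\<close>, which then are at cycle
    distance \<open>1\<close>, too close for a shortcut.\<close>
  have arcs: "(u, v) \<notin> set C \<and> (v, u) \<notin> set C" if uv: "(u, v) \<in> set \<sigma>" for u v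
  proof (rule ccontr)
    assume on: "\<not> ?thesis"
    then have "u \<in> cycle_vertex C ` {..<length C}" "v \<in> cycle_vertex C ` {..<length C}"
      using arc_ends_on_cycle[OF C, of u v] arc_ends_on_cycle[OF C, of v u] by auto
    then obtain k l where kl: "k < length C" "l < length C" "u = cycle_vertex C k" "v = cycle_vertex C l"
      by blast
    have "u \<noteq> v" using no_loops_in_apath[OF apath uv] by simp
    have "u \<in> set (pawalk_verts (cycle_vertex C i') \<sigma>)" "v \<in> set (pawalk_verts (cycle_vertex C i') \<sigma>)"
      using awalk_verts_arc1[OF uv] awalk_verts_arc2[OF awalkI_apath[OF apath] uv] by simp_all
    then have "{u, v} = {cycle_vertex C i', cycle_vertex C j'}"
      using inter[OF kl(1)] inter[OF kl(2)] kl(3,4) \<open>u \<noteq> v\<close> by auto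
    then have "(cycle_vertex C i', cycle_vertex C j') \<in> set C \<or> (cycle_vertex C j', cycle_vertex C i') \<in> set C"
      using on by (auto simp: doubleton_eq_iff)
    then have "cycle_dist C (real i') (real j') \<le> 1"
      using cycle_dist_le_1_if_adjacent[OF C i' j'] cycle_dist_le_1_if_adjacent[OF C j' i']
      by (auto simp: cycle_dist_commute)
    moreover have "length \<sigma> \<ge> 1" using uv by (cases \<sigma>) auto
    ultimately show False using shorter by linarith
  qed
  have "cycle_vertex C i' \<in> set (pawalk_verts (cycle_vertex C i') \<sigma>)"
    by (rule hd_in_awalk_verts(1)[OF awalkI_apath[OF apath]])
  moreover have "cycle_vertex C j' \<in> set (pawalk_verts (cycle_vertex C i') \<sigma>)"
    using awlast_of_awalk[OF awalkI_apath[OF apath]] awalk_verts_non_Nil[of "cycle_vertex C i'" \<sigma>]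
    by (metis NOMATCH_def last_in_set)
  ultimately have "set (pawalk_verts (cycle_vertex C i') \<sigma>) \<inter> cycle_vertex C ` {..<length C}
      = {cycle_vertex C i', cycle_vertex C j'}"
    using inter i' j' by auto
  then have "strict_shortcut C i' j' \<sigma>"
    using \<sigma> arcs unfolding strict_shortcut_def by (auto simp: P_def)
  then show ?thesis using near by (rule that)
qed

lemma strict_shortcut_less: "strict_shortcut C i j \<sigma> \<Longrightarrow> i < length C \<and> j < length C"
  unfolding strict_shortcut_def shortcut_def by blast

lemma strict_shortcut_length_pos:
  assumes C: "graph_cycle C" and \<sigma>: "strict_shortcut C i j \<sigma>"
  shows "length \<sigma> \<ge> 1"
proof (rule ccontr)
  assume "\<not> ?thesis"
  then have "\<sigma> = []" by (cases \<sigma>) auto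
  then have "cycle_vertex C i = cycle_vertex C j" "0 < cycle_dist C (real i) (real j)"
    and ij: "i < length C" "j < length C"
    using \<sigma> by (auto simp: strict_shortcut_def shortcut_def apath_simps)
  then show False using cycle_vertex_inj[OF C ij] by (auto simp: cycle_dist_def)
qed

section \<open>A shortcut near every edge of the cycle\<close>

text \<open>
  The bound is \<open>r - 1\<close> rather than \<open>r\<close> because the shortcut itself uses up at least one of the at most
  \<open>r\<close> steps of the walk from which it is extracted. The unit gained pays for the distance from
  a point of the edge to whichever end of the edge is the one named here.
\<close>

lemma shortcut_vertex_near_edge:
  assumes bounded: "\<And>S. minimal_vertex_r_separator r S \<Longrightarrow> gdiam S \<le> ereal (real r)"
    and r: "r \<ge> 1" and C: "graph_cycle C" and long: "length C \<ge> 2 * r + 2" and i: "i < length C"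
  obtains e j k \<sigma> where "e \<in> {i, Suc i mod length C}" "strict_shortcut C j k \<sigma>"
    "length \<sigma> \<le> r" "cycle_dist C (real e) (real j) \<le> real r - 1"
proof -
  note found = that
  let ?n = "length C"
  define c where "c k = cycle_vertex C ((i + k) mod ?n)" for k
  have pos: "(i + k) mod ?n < ?n" for k using i by (intro mod_less_divisor) auto
  have cn: "c ?n = c 0" by (simp add: c_def)
  have arc: "(c k, c (Suc k)) \<in> parcs G" for k
    using cycle_arc[OF C pos[of k]] by (simp add: c_def mod_Suc_eq)
  have inV: "c k \<in> pverts G" for k using arc[of k] by (rule wellformed')
  have dist_c: "gdist (c k) (c l) \<le> ereal (real d)" if "k \<le> l" "l - k \<le> d" for k l d
  proof (rule order_trans)
    show "gdist (c k) (c l) \<le> ereal (real (l - k))"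
      using gdist_cycle_le[OF C, of "i + k" "l - k"] that by (simp add: c_def)
    show "ereal (real (l - k)) \<le> ereal (real d)" using that(2) by simp
  qed
  \<comment> \<open>The last two bounds say that both arcs between \<open>c x\<close> and \<open>c y\<close> have length at
    least \<open>r + 1\<close>.\<close>
  have shortcut: thesis
    if near: "gdist (c x) (c y) \<le> ereal (real r)" and xy: "x \<le> 1" "x + r + 1 \<le> y" "y + r + 1 \<le> ?n + x"
    for x y
  proof -
    obtain p where p: "awalk (c x) p (c y)" "length p \<le> r" using near unfolding gdist_le_iff by blast
    have "real r + 1 \<le> cycle_dist C (real ((i + x) mod ?n)) (real ((i + y) mod ?n))"
      using cycle_dist_shift[of i C x y] i xy by (simp add: min_def)
    then have "real (length p) < cycle_dist C (real ((i + x) mod ?n)) (real ((i + y) mod ?n))"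
      using p(2) by linarith
    with C pos pos p(1) obtain j k \<sigma> where \<sigma>: "strict_shortcut C j k \<sigma>"
      "cycle_dist C (real ((i + x) mod ?n)) (real j) + real (length \<sigma>) \<le> real (length p)"
      unfolding c_def by (rule ex_strict_shortcut)
    have "length \<sigma> \<ge> 1" by (rule strict_shortcut_length_pos[OF C \<sigma>(1)])
    moreover have "cycle_dist C (real ((i + x) mod ?n)) (real j) \<ge> 0"
      using \<sigma>(1) pos[of x] unfolding strict_shortcut_def shortcut_def cycle_dist_def by auto
    moreover have "(i + x) mod ?n \<in> {i, Suc i mod ?n}" using i xy(1) by (cases x) auto
    ultimately show thesis using \<sigma> p(2) by (intro found[of "(i + x) mod ?n" j k \<sigma>]) auto
  qed
  show thesis
  proof (cases "gdist (c 0) (c (r + 1)) \<le> ereal (real r)")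
    case True
    then show ?thesis by (rule shortcut) (use long in auto)
  next
    case False
    then obtain S where S: "minimal_r_separator r (c 0) (c (r + 1)) S"
      using ex_minimal_r_separator[of "c 0" "c (r + 1)" r] inV r by (auto simp: not_le)
    then have sep: "r_separator r (c 0) (c (r + 1)) S" by (simp add: minimal_r_separator_def)
    then have a: "c 0 \<notin> S" and b: "c (r + 1) \<notin> S"
      and far: "\<And>v w. v \<in> component_minus S (c 0) \<Longrightarrow> w \<in> component_minus S (c (r + 1)) \<Longrightarrow>
        \<not> gdist v w \<le> ereal (real r)"
      by (auto simp: r_separator_def not_le)
    have a_in: "c 0 \<in> component_minus S (c 0)" by (rule component_minus_self[OF inV a])
    have b_in: "c (r + 1) \<in> component_minus S (c (r + 1))" by (rule component_minus_self[OF inV b])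
    have diam: "gdist u v \<le> ereal (real r)" if "u \<in> S" "v \<in> S" for u v
      using gdist_le_gdiam[OF that] bounded[of S] S
      unfolding minimal_vertex_r_separator_def by (blast intro: order_trans)
    have c1: "c 1 \<in> S"
    proof (rule ccontr)
      assume "c 1 \<notin> S"
      then have "c 1 \<in> component_minus S (c 0)"
        using component_minus_step[OF a_in arc] by simp
      from far[OF this b_in] dist_c[of 1 "r + 1" r] show False by simp
    qed
    have beyond: "c l \<in> component_minus S (c (r + 1))"
      if "r + 1 \<le> l" "\<And>k. r + 1 < k \<Longrightarrow> k \<le> l \<Longrightarrow> c k \<notin> S" for l
      using that
    proof (induct l rule: dec_induct)
      case base
      show ?case by (rule b_in)
    next
      case (step l)
      then show ?case using component_minus_step[OF _ arc] by simp
    qed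
    \<comment> \<open>If the walk from \<open>c (r + 1)\<close> onwards avoided \<open>S\<close>, it would reach \<open>c ?n = c 0\<close> and the two
      components would coincide.\<close>
    define Q where "Q k \<longleftrightarrow> r + 1 < k \<and> k \<le> ?n \<and> c k \<in> S" for k
    have "\<exists>k. Q k"
    proof (rule ccontr)
      assume "\<not> ?thesis"
      then have "c ?n \<in> component_minus S (c (r + 1))"
        using long unfolding Q_def by (intro beyond) auto
      from far[OF a_in this] dist_c[of 0 0 r] show False by (simp add: cn)
    qed
    then obtain k where "Q k" and min: "\<And>l. l < k \<Longrightarrow> \<not> Q l"
      unfolding exists_least_iff[of Q] by blast
    then have k: "r + 1 < k" "k \<le> ?n" "c k \<in> S" by (simp_all add: Q_def)
    have first: "c l \<notin> S" if "r + 1 < l" "l < k" for l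
      using min[OF that(2)] that k(2) by (simp add: Q_def)
    have "c (k - 1) \<in> component_minus S (c (r + 1))" using k(1) first by (intro beyond) auto
    from far[OF a_in this] have "\<not> gdist (c (k - 1)) (c ?n) \<le> ereal (real r)"
      unfolding cn using gdist_commute_le by blast
    then have "\<not> ?n - (k - 1) \<le> r" using dist_c[of "k - 1" ?n r] le_trans[OF diff_le_self k(2)] by blast
    \<comment> \<open>The arc from \<open>c k\<close> onwards to \<open>c (?n + 1) = c 1\<close> has length \<open>?n + 1 - k\<close>.\<close>
    then have "k + r + 1 \<le> ?n + 1" using k by linarith
    with diam[OF c1 k(3)] k(1) show ?thesis by (intro shortcut[of 1 k]) auto
  qed
qed

text \<open>
  One shortcut per edge of the cycle suffices, which makes the family finite.
\<close>

lemma densely_chordal_if_separators_bounded: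
  assumes bounded: "\<And>S. minimal_vertex_r_separator r S \<Longrightarrow> gdiam S \<le> ereal (real r)"
    and r: "r \<ge> 1"
  shows "densely_chordal (real r + 1/2) (2 * real r + 2) (real r)"
  unfolding densely_chordal_def
proof (intro allI impI, elim conjE)
  fix C assume C: "graph_cycle C" and "2 * real r + 2 \<le> real (length C)"
  then have long: "length C \<ge> 2 * r + 2" by linarith
  define near where "near i j \<longleftrightarrow>
    (\<exists>e\<in>{i, Suc i mod length C}. cycle_dist C (real e) (real j) \<le> real r - 1)" for i j
  have "\<forall>i\<in>{..<length C}. \<exists>j k \<sigma>. strict_shortcut C j k \<sigma> \<and> length \<sigma> \<le> r \<and> near i j"
  proof
    fix i assume "i \<in> {..<length C}"
    then have "i < length C" by simp
    with bounded r C long obtain e j k \<sigma> where "e \<in> {i, Suc i mod length C}"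
      "strict_shortcut C j k \<sigma>" "length \<sigma> \<le> r" "cycle_dist C (real e) (real j) \<le> real r - 1"
      by (rule shortcut_vertex_near_edge)
    then show "\<exists>j k \<sigma>. strict_shortcut C j k \<sigma> \<and> length \<sigma> \<le> r \<and> near i j"
      unfolding near_def by blast
  qed
  then obtain J K \<tau> where t: "\<forall>i\<in>{..<length C}.
      strict_shortcut C (J i) (K i) (\<tau> i) \<and> length (\<tau> i) \<le> r \<and> near i (J i)"
    by (auto dest!: bchoice)
  define F where "F = (\<lambda>i. (J i, K i, \<tau> i)) ` {..<length C}"
  have "eps_dense (cycle_points C) (cycle_dist C) (real r + 1/2) (\<Union>i<length C. {real (J i), real (K i)})"
    unfolding eps_dense_def
  proof (intro conjI ballI)
    show "(\<Union>i<length C. {real (J i), real (K i)}) \<subseteq> cycle_points C"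
    proof (rule UN_least)
      fix i assume "i \<in> {..<length C}"
      then have "J i < length C \<and> K i < length C"
        using bspec[OF t, of i] strict_shortcut_less[of C "J i" "K i" "\<tau> i"] by simp
      then show "{real (J i), real (K i)} \<subseteq> cycle_points C" by (simp add: cycle_points_def)
    qed
    fix x assume x: "x \<in> cycle_points C"
    \<comment> \<open>\<open>x\<close> lies on the edge from vertex \<open>i\<close> to its successor.\<close>
    define i where "i = nat \<lfloor>x\<rfloor>"
    have x': "0 \<le> x" "x < real (length C)" using x by (simp_all add: cycle_points_def)
    then have "real i = of_int \<lfloor>x\<rfloor>" unfolding i_def by simp
    then have i12: "real i \<le> x" "x < real i + 1" by (simp_all add: floor_le_iff)
    then have "real i < real (length C)" using x'(2) by linarith
    with i12 have i: "real i \<le> x" "x < real i + 1" "i < length C" by simp_all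
    define j where "j = J i"
    have "near i j" using bspec[OF t, of i] i(3) unfolding j_def by simp
    then obtain e where e: "e \<in> {i, Suc i mod length C}" "cycle_dist C (real e) (real j) \<le> real r - 1"
      unfolding near_def by blast
    have j: "j < length C"
      using bspec[OF t, of i] strict_shortcut_less[of C "J i" "K i" "\<tau> i"] i(3)
      unfolding j_def by simp
    have "Suc i mod length C < length C" using i(3) by (intro mod_less_divisor) auto
    then have el: "e < length C" using e(1) i(3) by auto
    have "cycle_dist C (real e) x \<le> 1"
    proof (cases "e = i")
      case True
      then show ?thesis using i by (simp add: cycle_dist_def)
    next
      case False
      then have "e = Suc i \<or> e = 0 \<and> Suc i = length C" using e(1) i(3) by (auto simp: mod_Suc)
      then show ?thesis using i(1,2) by (auto simp: cycle_dist_def)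
    qed
    then have "cycle_dist C (real j) x \<le> real r"
      using cycle_dist_triangle[of "real j" C "real e" x] x j el e(2)
        cycle_dist_commute[of C "real j" "real e"]
      by (simp add: cycle_points_def)
    then have "cycle_dist C (real j) x < real r + 1/2" by simp
    moreover have "real j \<in> (\<Union>i<length C. {real (J i), real (K i)})"
      using i(3) unfolding j_def by blast
    ultimately show "\<exists>a\<in>(\<Union>i<length C. {real (J i), real (K i)}). cycle_dist C a x < real r + 1/2"
      by blast
  qed
  moreover have "(\<Union>(i, j, \<sigma>)\<in>F. {real i, real j}) = (\<Union>i<length C. {real (J i), real (K i)})"
    by (simp add: F_def)
  moreover have "finite F" by (simp add: F_def)
  moreover have "\<forall>(i, j, \<sigma>)\<in>F. strict_shortcut C i j \<sigma> \<and> real (length \<sigma>) \<le> real r"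
    using t by (auto simp: F_def)
  ultimately show "\<exists>F. finite F \<and> (\<forall>(i, j, \<sigma>)\<in>F. strict_shortcut C i j \<sigma> \<and> real (length \<sigma>) \<le> real r) \<and>
      eps_dense (cycle_points C) (cycle_dist C) (real r + 1/2) (\<Union>(i, j, \<sigma>)\<in>F. {real i, real j})"
    by (intro exI[of _ F]) simp
qed

end

theorem theorem4p6:
  fixes G :: "'a pair_pre_digraph" and r :: nat and m :: real
  assumes "pair_bidirected_digraph G"
    and "Digraph_Component.connected (with_proj G)"
    and "pair_bidirected_digraph.is_uniform G"
    and "r \<ge> 2"
    and "m \<le> real r"
    and "\<forall>S. pair_bidirected_digraph.minimal_vertex_r_separator G r S \<longrightarrow>
           pair_bidirected_digraph.gdiam G S \<le> ereal m"
  shows "pair_bidirected_digraph.densely_chordal G (real r + 1/2) (2 * real r + 2) (real r)"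
proof -
  interpret pair_bidirected_digraph G by fact
  have "gdiam S \<le> ereal (real r)" if "minimal_vertex_r_separator r S" for S
  proof (rule order_trans)
    show "gdiam S \<le> ereal m" using assms(6) that by blast
    show "ereal m \<le> ereal (real r)" using assms(5) by simp
  qed
  moreover have "r \<ge> 1" using assms(4) by simp
  ultimately show ?thesis by (rule densely_chordal_if_separators_bounded)
qed

end
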